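(* Let $(\mathscr L,\leqslant)$ be a bounded lattice with least element $\perp$ and greatest element $\top$, let $(S,\leqslant)$ be a complete totally ordered set, and let $\mu:P_{<}(\mathscr L)\rightarrow S$ be a map. Assume the following conditions: (a) $\mu$ is convex, namely, for any $(x,y)\in\mathscr L^2$ such that $x\not\leqslant y$, one has $\mu(x\wedge y,x)\leqslant\mu(y,x\vee y)$. (b) $(\mathscr L,\leqslant)$ satisfies the ascending chain condition, namely, there does not exist any family $(x_n)_{n\in\mathbb N}$ of elements of $\mathscr L$ such that $x_0<x_1<\ldots<x_n<x_{n+1}<\ldots$. (c) $(\mathscr L,\leqslant)$ satisfies the $\mu_A$-descending chain condition, namely, for any $a\in\mathscr L$, there does not exist any family $(x_n)_{n\in\mathbb N}$ of elements of $\mathscr L$ such that $x_n>a$ for any $n$, $x_0>x_1>\ldots>x_n>x_{n+1}>\ldots$, and \[\mu_A(a,x_0)<\mu_A(a,x_1)<\ldots<\mu_A(a,x_n)<\mu_A(a,x_{n+1})<\ldots.\] Then there exists a unique increasing (finite) sequence \[\perp=a_0<a_1<\ldots<a_n=\top\] of elements of $\mathscr L$ such that: (1) for any $i\in\{1,\ldots,n\}$, the Harder-Narasimhan game on $\mathscr L_{[a_{i-1},a_i]}$ with pay-off function $\mu_{[a_{i-1},a_i]}$ is semi-stable; (2) $\mu_A(a_0,a_1)>\ldots>\mu_A(a_{n-1},a_n)$.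
   Context: A bounded lattice is a partially ordered set with least element $\perp$ and greatest element $\top$, $\perp\neq\top$, in which any two elements $x,y$ have a supremum $x\vee y$ and an infimum $x\wedge y$. $P_{<}(\mathscr L)=\{(x,y)\in\mathscr L^2\,|\,x<y\}$. A complete totally ordered set is a totally ordered set in which every subset has a supremum and an infimum. For $(x,y)\in P_{<}(\mathscr L)$, put \[\mu_A(x,y):=\inf_{a\in\mathscr L,\;x\leqslant a<y}\;\;\sup_{b\in\mathscr L,\;a<b\leqslant y}\mu(a,b).\] For $(x,y)\in P_{<}(\mathscr L)$, let $\mathscr L_{[x,y]}=\{z\in\mathscr L\,|\,x\leqslant z\leqslant y\}$ and let $\mu_{[x,y]}$ be the restriction of $\mu$ to $P_{<}(\mathscr L_{[x,y]})$. The Harder-Narasimhan game on $\mathscr L_{[x,y]}$ with pay-off function $\mu_{[x,y]}$ is said to be semi-stable if for any $z\in\mathscr L$ with $x<z\leqslant y$ one has $\mu_A(x,z)\not>\mu_A(x,y)$. *)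

theory Defs
  imports Main
begin

text \<open>
  A pay-off function is a map from the set of pairs \<open>x < y\<close> of \<open>'a\<close> to \<open>'b\<close>. It is encoded as a total
  curried function; none of the definitions below, for \<open>x < y\<close>, depends on its values \<open>\<mu> x y\<close> at
  pairs with \<open>\<not> x < y\<close>.
\<close>

definition mu_A :: "('a::bounded_lattice \<Rightarrow> 'a \<Rightarrow> 'b::complete_linorder) \<Rightarrow> 'a \<Rightarrow> 'a \<Rightarrow> 'b" where
  "mu_A \<mu> x y = (INF a \<in> {a. x \<le> a \<and> a < y}. SUP b \<in> {b. a < b \<and> b \<le> y}. \<mu> a b)"

text \<open>
  Semi-stability of the Harder-Narasimhan game on the interval \<open>[x, y]\<close>, for \<open>x < y\<close>. Since \<open>mu_A \<mu> x z\<close>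
  only involves pairs in the interval \<open>[x, z]\<close>, the restriction of \<open>\<mu>\<close> to \<open>[x, y]\<close> is left implicit.
\<close>

definition semistable_on :: "('a::bounded_lattice \<Rightarrow> 'a \<Rightarrow> 'b::complete_linorder) \<Rightarrow> 'a \<Rightarrow> 'a \<Rightarrow> bool" where
  "semistable_on \<mu> x y \<longleftrightarrow> (\<forall>z. x < z \<and> z \<le> y \<longrightarrow> \<not> mu_A \<mu> x z > mu_A \<mu> x y)"

definition convex_payoff :: "('a::bounded_lattice \<Rightarrow> 'a \<Rightarrow> 'b::complete_linorder) \<Rightarrow> bool" where
  "convex_payoff \<mu> \<longleftrightarrow> (\<forall>x y. \<not> x \<le> y \<longrightarrow> \<mu> (inf x y) x \<le> \<mu> y (sup x y))"

definition ascending_chain_condition :: "'a::bounded_lattice itself \<Rightarrow> bool" where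
  "ascending_chain_condition _ \<longleftrightarrow> (\<nexists>x :: nat \<Rightarrow> 'a. \<forall>n. x n < x (Suc n))"

definition mu_A_descending_chain_condition ::
  "('a::bounded_lattice \<Rightarrow> 'a \<Rightarrow> 'b::complete_linorder) \<Rightarrow> bool" where
  "mu_A_descending_chain_condition \<mu> \<longleftrightarrow>
     (\<forall>a. \<nexists>x :: nat \<Rightarrow> 'a. (\<forall>n. x n > a) \<and> (\<forall>n. x n > x (Suc n)) \<and>
            (\<forall>n. mu_A \<mu> a (x n) < mu_A \<mu> a (x (Suc n))))"

end

theory Submission
  imports Defs
begin

text \<open>
  Convexity passes from \<open>\<mu>\<close> to \<open>\<mu>\<^sub>A\<close>, and \<open>\<mu>\<^sub>A\<close> satisfies \<open>\<mu>\<^sub>A(x,z) \<ge> min(\<mu>\<^sub>A(x,y), \<mu>\<^sub>A(y,z))\<close>. Hence, for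
  fixed \<open>a\<close> and \<open>t\<close>, the set of all \<open>z > a\<close> with \<open>\<mu>\<^sub>A(a,z) \<ge> t\<close> is closed under joins and so has a greatest
  element by the ascending chain condition; the descending chain condition shows that
  \<open>\<mu>\<^sub>A(a,-)\<close> attains its maximum. Thus every \<open>a < \<top>\<close> has a unique successor: the greatest \<open>b\<close>
  among the maximizers of \<open>\<mu>\<^sub>A(a,-)\<close>. A chain ending in \<open>\<top>\<close> satisfies the two conditions of the theorem
  exactly if each of its elements is followed by its successor.
\<close>

definition greatest_destabilizing ::
  "('a::bounded_lattice \<Rightarrow> 'a \<Rightarrow> 'b::complete_linorder) \<Rightarrow> 'a \<Rightarrow> 'a \<Rightarrow> bool" where
  "greatest_destabilizing \<mu> a b \<longleftrightarrow>
     a < b \<and> (\<forall>z>a. mu_A \<mu> a z \<le> mu_A \<mu> a b \<and> (mu_A \<mu> a z = mu_A \<mu> a b \<longrightarrow> z \<le> b))"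

lemma greatest_destabilizing_unique:
  assumes "greatest_destabilizing \<mu> a b" "greatest_destabilizing \<mu> a c"
  shows "b = c"
  using assms unfolding greatest_destabilizing_def by (meson order.antisym)

section \<open>Inequalities for \<open>mu_A\<close>\<close>

lemma mu_A_mono_left:
  assumes "x \<le> x'"
  shows "mu_A \<mu> x y \<le> mu_A \<mu> x' y"
  unfolding mu_A_def using assms by (intro INF_superset_mono) auto

text \<open>Each \<open>b\<close> on the left is matched with \<open>sup a b\<close> on the right:
  \<open>inf b a = inf x a\<close>, so convexity at the pair \<open>b\<close>, \<open>a\<close>
  compares the two payoffs.\<close>

lemma SUP_payoff_inf_le:
  assumes "convex_payoff \<mu>"
  shows "(SUP b \<in> {b. inf x a < b \<and> b \<le> x}. \<mu> (inf x a) b) \<le> (SUP b \<in> {b. a < b \<and> b \<le> sup a x}. \<mu> a b)"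
proof (rule SUP_least)
  fix b assume "b \<in> {b. inf x a < b \<and> b \<le> x}"
  then have b: "inf x a < b" "b \<le> x" by auto
  then have "\<not> b \<le> a" by (meson le_infI leD)
  have "inf b a = inf x a"
    using b by (intro order.antisym) (auto intro: le_infI1 order.strict_implies_order)
  with \<open>\<not> b \<le> a\<close> assms have "\<mu> (inf x a) b \<le> \<mu> a (sup a b)"
    unfolding convex_payoff_def by (metis sup_commute)
  also have "sup a b \<in> {b. a < b \<and> b \<le> sup a x}"
    using b \<open>\<not> b \<le> a\<close> by (auto simp: le_supI2 less_le) (metis sup_ge2)
  then have "\<mu> a (sup a b) \<le> (SUP b \<in> {b. a < b \<and> b \<le> sup a x}. \<mu> a b)"
    by (rule SUP_upper)
  finally show "\<mu> (inf x a) b \<le> (SUP b \<in> {b. a < b \<and> b \<le> sup a x}. \<mu> a b)" .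
qed

text \<open>The term of the infimum at \<open>inf x a\<close> bounds \<open>mu_A \<mu> w x\<close>,
  and convexity moves this term up to \<open>a\<close>. Treating a single \<open>a\<close> serves
  both the convexity of \<open>mu_A\<close> and the concatenation of intervals.\<close>

lemma mu_A_le_SUP_join:
  assumes "convex_payoff \<mu>" "w \<le> x" "w \<le> a" "\<not> x \<le> a" "x \<le> z" "a \<le> z"
  shows "mu_A \<mu> w x \<le> (SUP b \<in> {b. a < b \<and> b \<le> z}. \<mu> a b)"
proof -
  have "mu_A \<mu> w x \<le> (SUP b \<in> {b. inf x a < b \<and> b \<le> x}. \<mu> (inf x a) b)"
    unfolding mu_A_def using assms by (intro INF_lower) (simp add: less_le, metis inf_le2)
  also have "\<dots> \<le> (SUP b \<in> {b. a < b \<and> b \<le> sup a x}. \<mu> a b)"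
    by (rule SUP_payoff_inf_le[OF assms(1)])
  also have "\<dots> \<le> (SUP b \<in> {b. a < b \<and> b \<le> z}. \<mu> a b)"
    using assms by (intro SUP_subset_mono) (auto intro: order.trans[of _ "sup a x"])
  finally show ?thesis .
qed

lemma mu_A_inf_le_sup:
  assumes "convex_payoff \<mu>" "\<not> x \<le> y"
  shows "mu_A \<mu> (inf x y) x \<le> mu_A \<mu> y (sup x y)"
  unfolding mu_A_def[of \<mu> y]
proof (rule INF_greatest)
  fix a assume "a \<in> {a. y \<le> a \<and> a < sup x y}"
  then have a: "y \<le> a" "a < sup x y" by auto
  then have "\<not> x \<le> a" by (meson le_supI not_less_iff_gr_or_eq order.strict_iff_not)
  with a show "mu_A \<mu> (inf x y) x \<le> (SUP b \<in> {b. a < b \<and> b \<le> sup x y}. \<mu> a b)"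
    using assms by (intro mu_A_le_SUP_join) (auto intro: le_infI2)
qed

text \<open>Bound the supremum at each \<open>a\<close> in the infimum for
  \<open>mu_A \<mu> x z\<close>: if \<open>y \<le> a\<close>, it is a term of
  \<open>mu_A \<mu> y z\<close>; otherwise it dominates \<open>mu_A \<mu> x y\<close> by
  convexity.\<close>

lemma mu_A_concat:
  assumes "convex_payoff \<mu>" "x \<le> y" "y \<le> z"
    and "t \<le> mu_A \<mu> x y" "t \<le> mu_A \<mu> y z"
  shows "t \<le> mu_A \<mu> x z"
  unfolding mu_A_def
proof (rule INF_greatest)
  fix a assume "a \<in> {a. x \<le> a \<and> a < z}"
  then have a: "x \<le> a" "a < z" by auto
  show "t \<le> (SUP b \<in> {b. a < b \<and> b \<le> z}. \<mu> a b)"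
  proof (cases "y \<le> a")
    case True
    with a have "mu_A \<mu> y z \<le> (SUP b \<in> {b. a < b \<and> b \<le> z}. \<mu> a b)"
      unfolding mu_A_def by (intro INF_lower) auto
    with assms(5) show ?thesis by (rule order.trans)
  next
    case False
    with a assms have "mu_A \<mu> x y \<le> (SUP b \<in> {b. a < b \<and> b \<le> z}. \<mu> a b)"
      by (intro mu_A_le_SUP_join) auto
    with assms(4) show ?thesis by (rule order.trans)
  qed
qed

text \<open>Go from \<open>a\<close> to \<open>y\<close>, then from \<open>y\<close> to
  \<open>sup x y\<close>; convexity bounds the second piece from below by the value at
  \<open>x\<close>.\<close>

lemma mu_A_sup:
  assumes "convex_payoff \<mu>" "a \<le> x" "a \<le> y" "t \<le> mu_A \<mu> a x" "t \<le> mu_A \<mu> a y"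
  shows "t \<le> mu_A \<mu> a (sup x y)"
proof (cases "x \<le> y")
  case True
  with assms show ?thesis by (simp add: sup_absorb2)
next
  case False
  have "t \<le> mu_A \<mu> (inf x y) x"
    using assms(4) mu_A_mono_left[of a "inf x y" \<mu> x] assms(2,3) by auto
  also have "\<dots> \<le> mu_A \<mu> y (sup x y)"
    by (rule mu_A_inf_le_sup[OF assms(1) False])
  finally show ?thesis
    by (rule mu_A_concat[OF assms(1,3) sup_ge2 assms(5)])
qed

section \<open>Existence of the greatest maximizer\<close>

lemma wf_greater:
  assumes "ascending_chain_condition TYPE('a::bounded_lattice)"
  shows "wf {(y, x::'a). x < y}"
  using assms unfolding ascending_chain_condition_def wf_iff_no_infinite_down_chain by auto

text \<open>The chain condition yields a maximal element, and closure under joins turns maximal into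
  greatest.\<close>

lemma greatest_of_sup_closed:
  fixes U :: "'a::bounded_lattice set"
  assumes acc: "ascending_chain_condition TYPE('a)" and "u \<in> U"
    and closed: "\<And>x y. x \<in> U \<Longrightarrow> y \<in> U \<Longrightarrow> sup x y \<in> U"
  obtains g where "g \<in> U" "\<And>z. z \<in> U \<Longrightarrow> z \<le> g"
proof -
  obtain g where g: "g \<in> U" "\<And>y. g < y \<Longrightarrow> y \<notin> U"
    using wfE_min[OF wf_greater[OF acc] \<open>u \<in> U\<close>] by auto
  have "z \<le> g" if "z \<in> U" for z
  proof -
    have "\<not> g < sup g z" using g closed[OF g(1) that] by blast
    then have "sup g z = g" by (simp add: less_le)
    then show ?thesis by (simp add: le_iff_sup sup_commute)
  qed
  with g(1) show ?thesis using that by blast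
qed

lemma greatest_destabilizing_exists:
  fixes \<mu> :: "'a::bounded_lattice \<Rightarrow> 'a \<Rightarrow> 'b::complete_linorder"
  assumes convex: "convex_payoff \<mu>"
    and acc: "ascending_chain_condition TYPE('a)"
    and dcc: "mu_A_descending_chain_condition \<mu>"
    and "a < top"
  shows "\<exists>b. greatest_destabilizing \<mu> a b"
proof (rule ccontr)
  assume none: "\<nexists>b. greatest_destabilizing \<mu> a b"
  \<comment> \<open>\<open>U t\<close> is a superlevel set of \<open>mu_A \<mu> a\<close>, and
    \<open>Q g\<close> says that \<open>g\<close> is greatest in the superlevel set of its own
    value. Among such elements a larger value forces a lower position, which is the shape of a chain
    excluded by \<open>dcc\<close>.\<close>
  define U where "U t = {z. a < z \<and> t \<le> mu_A \<mu> a z}" for t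
  define Q where "Q g \<longleftrightarrow> g \<in> U (mu_A \<mu> a g) \<and> (\<forall>z\<in>U (mu_A \<mu> a g). z \<le> g)" for g
  have Q_exists: "\<exists>g. Q g \<and> g \<in> U t" if u: "u \<in> U t" for u t
  proof -
    have "sup x y \<in> U t" if "x \<in> U t" "y \<in> U t" for x y
      using that mu_A_sup[OF convex, of a x y t]
      by (auto simp: U_def intro: less_supI1)
    then obtain g where g: "g \<in> U t" "\<And>z. z \<in> U t \<Longrightarrow> z \<le> g"
      using greatest_of_sup_closed[OF acc u] by blast
    \<comment> \<open>The value at \<open>g\<close> is at least \<open>t\<close>, so its own
      superlevel set lies inside \<open>U t\<close>.\<close>
    then have "Q g" unfolding Q_def by (auto simp: U_def)
    with g(1) show ?thesis by blast
  qed
  have step: "\<exists>g'. Q g' \<and> g' < g \<and> mu_A \<mu> a g < mu_A \<mu> a g'" if "Q g" for g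
  proof -
    from that have g: "a < g" "\<And>z. a < z \<Longrightarrow> mu_A \<mu> a g \<le> mu_A \<mu> a z \<Longrightarrow> z \<le> g"
      by (auto simp: Q_def U_def)
    \<comment> \<open>If no \<open>z\<close> had a larger value, \<open>Q g\<close> would make
      \<open>g\<close> the greatest maximizer.\<close>
    from none g obtain z where z: "a < z" "mu_A \<mu> a g < mu_A \<mu> a z"
      unfolding greatest_destabilizing_def by (metis linorder_not_less order_refl)
    then obtain g' where g': "Q g'" "g' \<in> U (mu_A \<mu> a z)"
      using Q_exists[of z "mu_A \<mu> a z"] by (auto simp: U_def)
    then have "a < g'" "mu_A \<mu> a g < mu_A \<mu> a g'" using z by (auto simp: U_def)
    \<comment> \<open>The larger value puts \<open>g'\<close> into the superlevel set of
      \<open>g\<close>, hence \<open>g' \<le> g\<close>; the values differ, so the inequality is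
      strict.\<close>
    with g(2)[of g'] g'(1) show ?thesis by (auto simp: less_le)
  qed
  obtain g0 where "Q g0"
    using Q_exists[of top "mu_A \<mu> a top"] \<open>a < top\<close> by (auto simp: U_def)
  then obtain f where f: "\<And>n. Q (f n)"
      "\<And>n. f (Suc n) < f n \<and> mu_A \<mu> a (f n) < mu_A \<mu> a (f (Suc n))"
    using dependent_nat_choice[of "\<lambda>_. Q" "\<lambda>_ g g'. g' < g \<and> mu_A \<mu> a g < mu_A \<mu> a g'"] step
    by metis
  then have "\<forall>n. a < f n" by (auto simp: Q_def U_def)
  with f(2) dcc show False unfolding mu_A_descending_chain_condition_def by blast
qed

section \<open>Harder-Narasimhan chains as iterated successors\<close>

lemma greatest_destabilizing_slope:
  assumes "convex_payoff \<mu>" "greatest_destabilizing \<mu> a b" "greatest_destabilizing \<mu> b c"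
  shows "mu_A \<mu> b c < mu_A \<mu> a b"
proof (rule ccontr)
  assume "\<not> mu_A \<mu> b c < mu_A \<mu> a b"
  moreover have "a < b" "b < c"
    using assms(2,3) by (auto simp: greatest_destabilizing_def)
  \<comment> \<open>If the slope did not drop, concatenation would make \<open>c\<close> a maximizer
    too, hence \<open>c \<le> b\<close>.\<close>
  ultimately have "mu_A \<mu> a b \<le> mu_A \<mu> a c"
    using assms(1) by (intro mu_A_concat[of \<mu> a b c]) auto
  then have "c \<le> b"
    using assms(2) \<open>a < b\<close> \<open>b < c\<close> unfolding greatest_destabilizing_def
    by (meson order.antisym order.strict_trans)
  with \<open>b < c\<close> show False by simp
qed

definition HN_chain :: "('a::bounded_lattice \<Rightarrow> 'a \<Rightarrow> 'b::complete_linorder) \<Rightarrow> 'a list \<Rightarrow> bool" where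
  "HN_chain \<mu> as \<longleftrightarrow>
     (\<forall>i. Suc i < length as \<longrightarrow> as ! i < as ! Suc i) \<and>
     (\<forall>i. Suc i < length as \<longrightarrow> semistable_on \<mu> (as ! i) (as ! Suc i)) \<and>
     (\<forall>i. Suc (Suc i) < length as \<longrightarrow>
        mu_A \<mu> (as ! i) (as ! Suc i) > mu_A \<mu> (as ! Suc i) (as ! Suc (Suc i)))"

text \<open>Given \<open>z\<close> above \<open>as ! i\<close>, take the step of the chain at which
  \<open>z\<close> is first reached. Convexity transports the value of \<open>z\<close> to that
  step, semi-stability bounds it by the slope there, and slopes decrease along the chain.\<close>

lemma HN_chain_greatest_destabilizing:
  assumes convex: "convex_payoff \<mu>" and hn: "HN_chain \<mu> as"
    and "last as = top" and i: "Suc i < length as"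
  shows "greatest_destabilizing \<mu> (as ! i) (as ! Suc i)"
proof -
  have less: "as ! j < as ! Suc j" if "Suc j < length as" for j
    using hn that by (simp add: HN_chain_def)
  have mono: "as ! j \<le> as ! k" if "j \<le> k" "k < length as" for j k
    using that
  proof (induction k rule: dec_induct)
    case (step n)
    with less[of n] show ?case by auto
  qed simp
  have slope: "mu_A \<mu> (as ! k) (as ! Suc k) < mu_A \<mu> (as ! i) (as ! Suc i)"
    if "Suc i \<le> k" "Suc k < length as" for k
    using that
  proof (induction k rule: dec_induct)
    case base
    with hn show ?case by (simp add: HN_chain_def)
  next
    case (step n)
    have "mu_A \<mu> (as ! Suc n) (as ! Suc (Suc n)) < mu_A \<mu> (as ! n) (as ! Suc n)"
      using hn step.prems by (simp add: HN_chain_def)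
    also have "\<dots> < mu_A \<mu> (as ! i) (as ! Suc i)"
      using step by simp
    finally show ?case .
  qed
  have "mu_A \<mu> (as ! i) z \<le> mu_A \<mu> (as ! i) (as ! Suc i) \<and>
      (mu_A \<mu> (as ! i) z = mu_A \<mu> (as ! i) (as ! Suc i) \<longrightarrow> z \<le> as ! Suc i)"
    if z: "as ! i < z" for z
  proof -
    have last: "z \<le> as ! (length as - 1)"
      using \<open>last as = top\<close> i by (metis last_conv_nth list.size(3) not_less_zero top_greatest)
    define j where "j = (LEAST j. z \<le> as ! j)"
    have j: "z \<le> as ! j" "j \<le> length as - 1"
      unfolding j_def using last by (auto intro: LeastI Least_le)
    then have "j < length as" using i by linarith
    have "i < j"
    proof (rule ccontr)
      assume "\<not> i < j"
      then have "as ! j \<le> as ! i" using mono[of j i] i by simp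
      with j(1) z show False by auto
    qed
    \<comment> \<open>By minimality of \<open>j\<close>, \<open>z\<close> lies below
      \<open>as ! Suc k\<close> but not below \<open>as ! k\<close>.\<close>
    then obtain k where k: "j = Suc k" "i \<le> k" by (cases j) auto
    have not_below: "\<not> z \<le> as ! k" using k(1) not_less_Least[of k "\<lambda>j. z \<le> as ! j"] j_def by auto
    have le: "as ! i \<le> as ! k" using mono k \<open>j < length as\<close> by simp
    have "mu_A \<mu> (as ! i) z \<le> mu_A \<mu> (inf z (as ! k)) z"
      using z le by (intro mu_A_mono_left) auto
    also have "\<dots> \<le> mu_A \<mu> (as ! k) (sup z (as ! k))"
      by (rule mu_A_inf_le_sup[OF convex not_below])
    also have "\<dots> \<le> mu_A \<mu> (as ! k) (as ! Suc k)"
    proof -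
      have "as ! k < sup z (as ! k)"
        using not_below by (metis less_le sup_ge1 sup_ge2)
      moreover have "sup z (as ! k) \<le> as ! Suc k"
        using j(1) k(1) less[of k] \<open>j < length as\<close> by auto
      moreover have "semistable_on \<mu> (as ! k) (as ! Suc k)"
        using hn k(1) \<open>j < length as\<close> by (simp add: HN_chain_def)
      ultimately show ?thesis by (auto simp: semistable_on_def not_less)
    qed
    finally have le': "mu_A \<mu> (as ! i) z \<le> mu_A \<mu> (as ! k) (as ! Suc k)" .
    show ?thesis
    \<comment> \<open>For \<open>k = i\<close> the choice of \<open>k\<close> already gives
      \<open>z \<le> as ! Suc i\<close>; for later \<open>k\<close> the value of \<open>z\<close> is
      strictly smaller, so equality cannot occur.\<close>
    proof (cases "k = i")
      case True
      with le' j(1) k(1) show ?thesis by simp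
    next
      case False
      with slope[of k] k \<open>j < length as\<close> le' show ?thesis by auto
    qed
  qed
  with less[OF i] show ?thesis by (simp add: greatest_destabilizing_def)
qed

text \<open>This trades the chain conditions for a relation between neighbours in which the
  successor is determined, so that existence and uniqueness reduce to following it from the
  bottom.\<close>

lemma HN_chain_iff_successively:
  assumes convex: "convex_payoff \<mu>" and "last as = top"
  shows "HN_chain \<mu> as \<longleftrightarrow> successively (greatest_destabilizing \<mu>) as"
proof
  assume "HN_chain \<mu> as"
  with assms show "successively (greatest_destabilizing \<mu>) as"
    by (auto simp: successively_conv_nth intro: HN_chain_greatest_destabilizing)
next
  assume "successively (greatest_destabilizing \<mu>) as"
  then have gd: "greatest_destabilizing \<mu> (as ! i) (as ! Suc i)" if "Suc i < length as" for i
    using that by (simp add: successively_conv_nth)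
  show "HN_chain \<mu> as"
    unfolding HN_chain_def
  proof (intro conjI allI impI)
    fix i assume "Suc i < length as"
    \<comment> \<open>Maximality over all \<open>z\<close> above \<open>as ! i\<close> includes the
      \<open>z\<close> in the interval, which is semi-stability.\<close>
    from gd[OF this] show "as ! i < as ! Suc i" "semistable_on \<mu> (as ! i) (as ! Suc i)"
      by (auto simp: greatest_destabilizing_def semistable_on_def not_less)
  next
    fix i assume "Suc (Suc i) < length as"
    then show "mu_A \<mu> (as ! Suc i) (as ! Suc (Suc i)) < mu_A \<mu> (as ! i) (as ! Suc i)"
      using gd by (intro greatest_destabilizing_slope[OF convex]) auto
  qed
qed

text \<open>Induction on the reversed order, well-founded by \<open>acc\<close>: the hypothesis is
  available for all elements above \<open>x\<close>, in particular for its successor, which is the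
  forced second entry.\<close>

lemma ex1_successively_to_top:
  fixes R :: "'a::bounded_lattice \<Rightarrow> 'a \<Rightarrow> bool"
  assumes acc: "ascending_chain_condition TYPE('a)"
    and less: "\<And>x y. R x y \<Longrightarrow> x < y"
    and ex: "\<And>x. x < top \<Longrightarrow> \<exists>y. R x y"
    and unique: "\<And>x y z. R x y \<Longrightarrow> R x z \<Longrightarrow> y = z"
  shows "\<exists>!as. as \<noteq> [] \<and> hd as = x \<and> last as = top \<and> successively R as"
proof (induction x rule: wf_induct_rule[OF wf_greater[OF acc]])
  case (1 x)
  show ?case
  proof (cases "x = top")
    case True
    show ?thesis
    proof (rule ex1I)
      show "[x] \<noteq> [] \<and> hd [x] = x \<and> last [x] = top \<and> successively R [x]"
        using True by simp
    next
      fix as assume as: "as \<noteq> [] \<and> hd as = x \<and> last as = top \<and> successively R as"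
      then obtain bs where "as = x # bs" by (cases as) auto
      \<comment> \<open>A further entry would lie strictly above \<open>top\<close>.\<close>
      moreover have "bs = []"
        using as less[of x] True \<open>as = x # bs\<close> by (cases bs) (auto simp: less_le top_unique)
      ultimately show "as = [x]" by simp
    qed
  next
    case False
    then obtain y where y: "R x y" using ex[of x] by (auto simp: less_le)
    with less 1 obtain bs where
      bs: "bs \<noteq> []" "hd bs = y" "last bs = top" "successively R bs" and
      bs_unique: "\<And>cs. cs \<noteq> [] \<Longrightarrow> hd cs = y \<Longrightarrow> last cs = top \<Longrightarrow> successively R cs \<Longrightarrow> cs = bs"
      by (metis (mono_tags, lifting) case_prodI mem_Collect_eq)
    show ?thesis
    proof (rule ex1I)
      show "x # bs \<noteq> [] \<and> hd (x # bs) = x \<and> last (x # bs) = top \<and> successively R (x # bs)"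
        using bs y by (simp add: successively_Cons)
    next
      fix as assume as: "as \<noteq> [] \<and> hd as = x \<and> last as = top \<and> successively R as"
      then obtain cs where cs: "as = x # cs" by (cases as) auto
      have "cs \<noteq> []" using as cs False by auto
      moreover from this have "hd cs = y"
        using as cs y by (auto simp: successively_Cons intro: unique)
      ultimately have "cs = bs"
        using as cs by (intro bs_unique) (auto simp: successively_Cons)
      with cs show "as = x # bs" by simp
    qed
  qed
qed

theorem theorem1p1:
  fixes \<mu> :: "'a::bounded_lattice \<Rightarrow> 'a \<Rightarrow> 'b::complete_linorder"
  assumes "(bot :: 'a) \<noteq> top"
    and "convex_payoff \<mu>"
    and "ascending_chain_condition TYPE('a)"
    and "mu_A_descending_chain_condition \<mu>"
  shows "\<exists>!as :: 'a list.
           as \<noteq> [] \<and> hd as = bot \<and> last as = top \<and>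
           (\<forall>i. Suc i < length as \<longrightarrow> as ! i < as ! Suc i) \<and>
           (\<forall>i. Suc i < length as \<longrightarrow> semistable_on \<mu> (as ! i) (as ! Suc i)) \<and>
           (\<forall>i. Suc (Suc i) < length as \<longrightarrow>
              mu_A \<mu> (as ! i) (as ! Suc i) > mu_A \<mu> (as ! Suc i) (as ! Suc (Suc i)))"
proof -
  have "\<exists>!as. as \<noteq> [] \<and> hd as = bot \<and> last as = top \<and> successively (greatest_destabilizing \<mu>) as"
  proof (rule ex1_successively_to_top[OF assms(3)])
    show "\<exists>y. greatest_destabilizing \<mu> x y" if "x < top" for x
      using greatest_destabilizing_exists[OF assms(2-4) that] .
  qed (auto simp: greatest_destabilizing_def intro: greatest_destabilizing_unique)
  then have "\<exists>!as. as \<noteq> [] \<and> hd as = bot \<and> last as = top \<and> HN_chain \<mu> as"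
    using HN_chain_iff_successively[OF assms(2)] by metis
  then show ?thesis unfolding HN_chain_def .
qed

end
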